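(* Let $l,k\in\mathbb{N}$ be such that $l<k$. For distinct $a_i,b_j\in(0,\infty)$, $i=0,1,\dots,l$ and $j=0,1,\dots,k$, let $$a(x)=a_0\prod_{j=1}^{l}(x+a_j),\qquad b(x)=b_0\prod_{j=1}^{k}(x+b_j),\qquad x\in\mathbb{R}_+,$$ and let $p:\mathbb{R}_+^2\to(0,\infty)$ be the polynomial in two variables of bi-degree $(k,1)$ defined by $p(x,y)=b(x)+a(x)y$. Then: (i) In the case $l=k-1$: if $b_1\le a_1\le b_2\le a_2\le\dots\le a_{l}\le b_k$, then $\left\{\frac{1}{p(m,n)}\right\}_{m,n\in\mathbb{Z}_+}$ is a joint completely monotone net. (ii) If $\left\{\frac{1}{p(m,n)}\right\}_{m,n\in\mathbb{Z}_+}$ is a joint completely monotone net, then $$\sum_{j=1}^{l}\frac{1}{a_j}\le\sum_{j=1}^{k}\frac{1}{b_j}.$$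
   Context: $\mathbb{N}$ is the set of positive integers, $\mathbb{Z}_+$ the set of nonnegative integers, $\mathbb{R}_+$ the set of nonnegative real numbers. For a net $\{x_\alpha\}_{\alpha\in\mathbb{Z}_+^n}$ of real numbers and $i=1,\dots,n$, the forward difference operator is $\Delta_i x_\alpha=x_{\alpha+\varepsilon_i}-x_\alpha$, where $\varepsilon_i$ is the $n$-tuple with $i$-th entry $1$ and $0$ elsewhere. These operators commute; for $\beta=(\beta_1,\dots,\beta_n)\in\mathbb{Z}_+^n$ put $\Delta^\beta=\prod_{i=1}^n\Delta_i^{\beta_i}$ and $|\beta|=\beta_1+\dots+\beta_n$. The net is joint completely monotone if $(-1)^{|\beta|}\Delta^\beta x_\alpha\ge 0$ for all $\alpha,\beta\in\mathbb{Z}_+^n$. Here $n=2$ is used, with the net indexed by $(m,n)\in\mathbb{Z}_+^2$. A polynomial $p$ in two variables $x_1,x_2$ has bi-degree $(\alpha_1,\alpha_2)\in\mathbb{Z}_+^2$ if for each $j=1,2$, $\alpha_j$ is the largest integer for which $\partial_j^{\alpha_j}p\neq 0$. *)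

theory Defs
  imports Complex_Main
begin

text \<open>A net indexed by pairs of nonnegative integers is a curried function on \<^typ>\<open>nat\<close>;
  only the two-parameter case is needed.\<close>

definition fdiff1 :: "(nat \<Rightarrow> nat \<Rightarrow> real) \<Rightarrow> nat \<Rightarrow> nat \<Rightarrow> real" where
  "fdiff1 x = (\<lambda>m n. x (m + 1) n - x m n)"

definition fdiff2 :: "(nat \<Rightarrow> nat \<Rightarrow> real) \<Rightarrow> nat \<Rightarrow> nat \<Rightarrow> real" where
  "fdiff2 x = (\<lambda>m n. x m (n + 1) - x m n)"

definition joint_completely_monotone :: "(nat \<Rightarrow> nat \<Rightarrow> real) \<Rightarrow> bool" where
  "joint_completely_monotone x \<longleftrightarrow>
     (\<forall>\<alpha>1 \<alpha>2 \<beta>1 \<beta>2. (- 1) ^ (\<beta>1 + \<beta>2) * (fdiff1 ^^ \<beta>1) ((fdiff2 ^^ \<beta>2) x) \<alpha>1 \<alpha>2 \<ge> 0)"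

end

theory Submission
  imports Defs "HOL-Analysis.Analysis" "HOL-Real_Asymp.Real_Asymp"
    "HOL-Computational_Algebra.Fundamental_Theorem_Algebra"
begin

text \<open>Put \<open>C = b / a\<close>. Since
\<open>1 / p(x, y) = 1 / (a(x) (C(x) + y))\<close>, the differences in the second variable
are explicit: up to the alternating sign, the \<open>j\<close>-th one is
  \<open>j! / (a(x) (C(x) + y) (C(x) + y + 1) \<dots> (C(x) + y + j))\<close>,
and joint complete monotonicity of the net says that each of these kernels is a completely
monotone sequence in \<open>x = 0, 1, 2, \<dots>\<close>.

If the zeros interlace, then \<open>C(x)\<close> is a positive multiple of
\<open>x + c - (\<Sum>j. r j / (x + a j))\<close> with all \<open>r j \<ge> 0\<close>
(\<open>interlacing_partial_fractions\<close>). So \<open>C\<close> is a discrete Bernstein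
function: its increments are completely monotone. The reciprocal of a positive sequence with
this property is completely monotone (\<open>cm_upto_inverse\<close>), products of
completely monotone sequences are completely monotone, and hence so is every kernel.

For the inequality between the reciprocal sums, note that it says
\<open>C'(0) \<ge> 0\<close>, because
\<open>C'(0) / C(0) = (\<Sum>j. 1 / b j) - (\<Sum>j. 1 / a j)\<close>. The hypothesis only
concerns integer points, so the derivative at \<open>0\<close> has to be recovered from
them. Formally, Newton's forward interpolation gives
  \<open>- f'(0) = (\<Sum>j\<ge>1. (-1)^j \<Delta>^j f(0) / j)\<close>,
whose terms are nonnegative for a completely monotone sequence. For \<open>f = 1 / P\<close>
with a polynomial \<open>P\<close> the formula holds if all complex roots of
\<open>P\<close> lie in the open left half plane (\<open>newton_slope_inverse_poly\<close>).
For \<open>P(x) = b(x) + a(x) n\<close> this is the case for all large \<open>n\<close> if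
\<open>b\<close> has degree \<open>l + 1\<close>: then
\<open>C(z) - z b\<^sub>0 / a\<^sub>0\<close> is bounded on the right half plane, where
\<open>C(z) = - n\<close> is therefore impossible. Differencing the resulting formula in
\<open>n\<close>, one obtains that
\<open>n \<mapsto> - \<partial>\<^sub>x (1 / p)(0, n)\<close> is completely monotone for
large \<open>n\<close>. This function has the form
\<open>\<alpha> / (\<gamma> + n) + \<delta> / (\<gamma> + n)\<^sup>2\<close>, where
\<open>\<delta>\<close> has the sign of \<open>C'(0)\<close>; in high differences the second
term wins by a harmonic sum, so \<open>\<delta> \<ge> 0\<close>.

The case of a larger degree gap is excluded beforehand. Completely monotone sequences are
logarithmically convex (\<open>cm_log_convex\<close>). The \<open>j\<close>-th kernel at
\<open>y = 0\<close> decays like \<open>j powr (- C(x))\<close> for large \<open>j\<close>,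
so logarithmic convexity for all \<open>j\<close> forces \<open>C\<close> to be concave on
the nonnegative integers. But \<open>C\<close> grows at least quadratically if the degrees
differ by more than one.\<close>

section \<open>Backward differences\<close>

text \<open>The negative of the forward difference, so that complete monotonicity becomes plain
nonnegativity of all iterates, without alternating signs. The values are not restricted to
the reals because Newton interpolation is applied to complex sequences.\<close>

definition bdiff :: "(nat \<Rightarrow> 'a::ab_group_add) \<Rightarrow> nat \<Rightarrow> 'a" where
  "bdiff f = (\<lambda>m. f m - f (Suc m))"

lemma bdiff_pow_Suc: "(bdiff ^^ Suc j) f m = (bdiff ^^ j) f m - (bdiff ^^ j) f (Suc m)"
  by (simp add: bdiff_def)

lemma bdiff_pow_Suc_inner: "(bdiff ^^ Suc j) f = (bdiff ^^ j) (bdiff f)"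
  by (simp only: funpow_Suc_right o_apply)

lemma bdiff_pow_add: "(bdiff ^^ j) (\<lambda>m. f m + g m) m = (bdiff ^^ j) f m + (bdiff ^^ j) g m"
  by (induction j arbitrary: m) (simp_all add: bdiff_def)

lemma bdiff_pow_diff: "(bdiff ^^ j) (\<lambda>m. f m - g m) m = (bdiff ^^ j) f m - (bdiff ^^ j) g m"
  by (induction j arbitrary: m) (simp_all add: bdiff_def)

lemma bdiff_pow_cmult:
  fixes c :: "'a::ring"
  shows "(bdiff ^^ j) (\<lambda>m. c * f m) m = c * (bdiff ^^ j) f m"
  by (induction j arbitrary: m) (simp_all add: bdiff_def right_diff_distrib)

lemma bdiff_pow_zero: "(bdiff ^^ j) (\<lambda>m. 0) m = 0"
  by (induction j arbitrary: m) (simp_all add: bdiff_def)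

lemma bdiff_pow_const: "0 < j \<Longrightarrow> (bdiff ^^ j) (\<lambda>m. c) m = 0"
  by (cases j) (simp_all add: bdiff_pow_Suc_inner bdiff_def bdiff_pow_zero del: funpow.simps)

lemma bdiff_pow_sum: "(bdiff ^^ j) (\<lambda>m. \<Sum>i\<in>I. f i m) m = (\<Sum>i\<in>I. (bdiff ^^ j) (f i) m)"
  by (induction j arbitrary: m) (simp_all add: bdiff_def sum_subtractf)

lemma bdiff_pow_of_real:
  "(bdiff ^^ j) (\<lambda>m. of_real (f m)) m = of_real ((bdiff ^^ j) f m)"
  by (induction j arbitrary: m) (simp_all add: bdiff_def)

lemma bdiff_pow_shift: "(bdiff ^^ j) (\<lambda>m. f (m + r)) m = (bdiff ^^ j) f (m + r)"
  by (induction j arbitrary: m) (simp_all add: bdiff_def)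

lemma bdiff_pow_commute:
  "(bdiff ^^ i) (\<lambda>m. (bdiff ^^ j) (x m) n) m = (bdiff ^^ j) (\<lambda>n. (bdiff ^^ i) (\<lambda>m. x m n) m) n"
  by (induction j arbitrary: n) (simp_all only: funpow_0 bdiff_pow_Suc bdiff_pow_diff)

lemma bdiff_pow_tendsto:
  fixes F :: "'b \<Rightarrow> nat \<Rightarrow> 'a::real_normed_vector"
  assumes "\<And>n. n \<ge> n0 \<Longrightarrow> ((\<lambda>J. F J n) \<longlongrightarrow> G n) H" and "n \<ge> n0"
  shows "((\<lambda>J. (bdiff ^^ j) (F J) n) \<longlongrightarrow> (bdiff ^^ j) G n) H"
  using assms(2)
proof (induction j arbitrary: n)
  case (Suc j)
  then show ?case unfolding bdiff_pow_Suc by (intro tendsto_diff) auto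
qed (simp add: assms(1))

text \<open>The Leibniz rule for a linear factor, whose differences of order two and more vanish. The
shifted difference of order \<open>j\<close> that it produces is expressed by unshifted
ones, which leaves a two-term recursion in \<open>j\<close> at each fixed point.\<close>

lemma bdiff_pow_mult_linear:
  fixes f :: "nat \<Rightarrow> 'a::comm_ring_1"
  shows "(bdiff ^^ Suc j) (\<lambda>m. (of_nat m + \<rho>) * f m) m
       = (of_nat m + \<rho> + of_nat (Suc j)) * (bdiff ^^ Suc j) f m - of_nat (Suc j) * (bdiff ^^ j) f m"
proof (induction j arbitrary: m)
  case 0
  then show ?case by (simp add: bdiff_def algebra_simps)
next
  case (Suc j)
  show ?case
    by (simp only: bdiff_pow_Suc[of "Suc j"] Suc.IH) (simp only: bdiff_pow_Suc, simp add: algebra_simps)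
qed

lemma fdiff1_pow: "(fdiff1 ^^ j) x m n = (-1) ^ j * (bdiff ^^ j) (\<lambda>m. x m n) m"
  by (induction j arbitrary: m) (simp_all add: fdiff1_def bdiff_def algebra_simps)

lemma fdiff2_pow: "(fdiff2 ^^ j) x m n = (-1) ^ j * (bdiff ^^ j) (x m) n"
  by (induction j arbitrary: n) (simp_all add: fdiff2_def bdiff_def algebra_simps)

lemma joint_completely_monotone_iff:
  "joint_completely_monotone x \<longleftrightarrow>
     (\<forall>i j m n. 0 \<le> (bdiff ^^ i) (\<lambda>m. (bdiff ^^ j) (x m) n) m)"
proof -
  have "(- 1) ^ (i + j) * (fdiff1 ^^ i) ((fdiff2 ^^ j) x) m n
      = (bdiff ^^ i) (\<lambda>m. (bdiff ^^ j) (x m) n) m" for i j m n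
  proof -
    have "(- 1) ^ (i + j) * (- 1) ^ i * (- 1) ^ j = (1::real)"
      by (simp add: minus_one_power_iff)
    then show ?thesis
      by (simp add: fdiff1_pow fdiff2_pow bdiff_pow_cmult flip: mult.assoc)
  qed
  then show ?thesis by (auto simp: joint_completely_monotone_def)
qed

lemma bdiff_pow_inverse_linear:
  fixes c :: real
  assumes "0 < c"
  shows "(bdiff ^^ j) (\<lambda>n. 1 / (c + real n)) n = fact j / pochhammer (c + real n) (Suc j)"
proof (induction j arbitrary: n)
  case (Suc j)
  define z where "z = c + real n"
  have z: "z > 0" "pochhammer (z + 1) j > 0" using assms by (auto simp: z_def intro!: pochhammer_pos)
  have 1: "pochhammer (z + 1) (Suc j) = pochhammer (z + 1) j * (z + 1 + real j)"
    by (simp add: pochhammer_Suc)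
  have 2: "pochhammer z (Suc j) = z * pochhammer (z + 1) j" by (simp add: pochhammer_rec)
  have 3: "pochhammer z (Suc (Suc j)) = z * (pochhammer (z + 1) j * (z + 1 + real j))"
    by (simp only: pochhammer_rec[of z] 1)
  have "(bdiff ^^ Suc j) (\<lambda>n. 1 / (c + real n)) n
      = fact j / pochhammer z (Suc j) - fact j / pochhammer (z + 1) (Suc j)"
    by (simp only: bdiff_pow_Suc Suc.IH) (simp add: z_def add_ac)
  also have "\<dots> = fact (Suc j) / pochhammer z (Suc (Suc j))"
    using z unfolding 1 2 3 by (simp add: divide_simps) (simp add: algebra_simps)
  finally show ?case by (simp only: z_def)
qed simp

text \<open>This is minus the derivative in \<open>c\<close> of the formula for
\<open>1 / (c + n)\<close>; the harmonic-type sum is the logarithmic derivative of the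
Pochhammer symbol.\<close>

lemma bdiff_pow_inverse_square:
  fixes c :: real
  assumes "0 < c"
  shows "(bdiff ^^ j) (\<lambda>n. 1 / (c + real n)\<^sup>2) n
       = fact j / pochhammer (c + real n) (Suc j) * (\<Sum>i\<le>j. 1 / (c + real n + real i))"
proof (induction j arbitrary: n)
  case 0
  then show ?case by (simp add: power2_eq_square)
next
  case (Suc j)
  define z where "z = c + real n"
  define w where "w = pochhammer (z + 1) j"
  define T where "T = (\<Sum>i<j. 1 / (z + 1 + real i))"
  have z: "z > 0" "w > 0" using assms by (auto simp: z_def w_def intro!: pochhammer_pos)
  have 1: "pochhammer (z + 1) (Suc j) = w * (z + 1 + real j)"
    by (simp add: pochhammer_Suc w_def)
  have 2: "pochhammer z (Suc j) = z * w" by (simp add: pochhammer_rec w_def)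
  have 3: "pochhammer z (Suc (Suc j)) = z * (w * (z + 1 + real j))"
    by (simp only: pochhammer_rec[of z] 1)
  have S1: "(\<Sum>i\<le>j. 1 / (z + 1 + real i)) = T + 1 / (z + 1 + real j)"
    by (simp add: T_def flip: lessThan_Suc_atMost)
  have S2: "(\<Sum>i\<le>j. 1 / (z + real i)) = 1 / z + T"
    by (simp add: T_def sum.lessThan_Suc_shift add_ac del: sum.lessThan_Suc flip: lessThan_Suc_atMost)
  have S3: "(\<Sum>i\<le>Suc j. 1 / (z + real i)) = 1 / z + T + 1 / (z + 1 + real j)"
    by (simp only: sum.atMost_Suc S2) (simp add: add_ac)
  have "(bdiff ^^ Suc j) (\<lambda>n. 1 / (c + real n)\<^sup>2) n
      = fact j / pochhammer z (Suc j) * (\<Sum>i\<le>j. 1 / (z + real i))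
        - fact j / pochhammer (z + 1) (Suc j) * (\<Sum>i\<le>j. 1 / (z + 1 + real i))"
    by (simp only: bdiff_pow_Suc Suc.IH) (simp add: z_def add_ac)
  also have "\<dots> = fact (Suc j) / pochhammer z (Suc (Suc j)) * (\<Sum>i\<le>Suc j. 1 / (z + real i))"
    using z unfolding 1 2 3 S1 S2 S3 by (simp add: divide_simps) (simp add: algebra_simps power2_eq_square)
  finally show ?case by (simp only: z_def)
qed

section \<open>Completely monotone sequences\<close>

text \<open>Truncating complete monotonicity at order \<open>N\<close> makes induction on
\<open>N\<close> possible: the difference of a product or of a reciprocal is built from the
same sequences, which are then needed to one order less.\<close>

definition cm_upto :: "nat \<Rightarrow> (nat \<Rightarrow> real) \<Rightarrow> bool" where
  "cm_upto N f \<longleftrightarrow> (\<forall>j\<le>N. \<forall>m. 0 \<le> (bdiff ^^ j) f m)"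

lemma cm_upto_Suc: "cm_upto (Suc N) f \<longleftrightarrow> (\<forall>m. 0 \<le> f m) \<and> cm_upto N (bdiff f)"
proof -
  have "(\<forall>j\<le>Suc N. Q j) \<longleftrightarrow> Q 0 \<and> (\<forall>j\<le>N. Q (Suc j))" for Q
    by (metis Suc_le_mono le_0_eq not0_implies_Suc zero_le)
  then show ?thesis
    by (simp add: cm_upto_def bdiff_pow_Suc_inner del: funpow.simps) 
qed

lemma cm_upto_0: "cm_upto 0 f \<longleftrightarrow> (\<forall>m. 0 \<le> f m)"
  by (simp add: cm_upto_def)

lemma cm_upto_mono: "cm_upto N f \<Longrightarrow> M \<le> N \<Longrightarrow> cm_upto M f"
  by (simp add: cm_upto_def)

lemma cm_upto_add: "cm_upto N f \<Longrightarrow> cm_upto N g \<Longrightarrow> cm_upto N (\<lambda>m. f m + g m)"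
  by (simp add: cm_upto_def bdiff_pow_add)

lemma cm_upto_const: "0 \<le> c \<Longrightarrow> cm_upto N (\<lambda>m. c)"
  by (auto simp: cm_upto_def bdiff_pow_const dest: gr0_implies_Suc) (metis bdiff_pow_const funpow_0 gr0I order_refl)

lemma cm_upto_shift: "cm_upto N f \<Longrightarrow> cm_upto N (\<lambda>m. f (Suc m))"
  by (simp add: cm_upto_def bdiff_pow_shift[where r = 1, simplified])

lemma cm_upto_mult: "cm_upto N f \<Longrightarrow> cm_upto N g \<Longrightarrow> cm_upto N (\<lambda>m. f m * g m)"
proof (induction N arbitrary: f g)
  case (Suc N)
  have "bdiff (\<lambda>m. f m * g m) = (\<lambda>m. f m * bdiff g m + bdiff f m * g (Suc m))"
    by (simp add: bdiff_def algebra_simps)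
  moreover have "cm_upto N f" "cm_upto N (\<lambda>m. g (Suc m))"
    using Suc.prems cm_upto_mono[of "Suc N" _ N] cm_upto_shift by auto
  ultimately show ?case
    using Suc by (auto simp: cm_upto_Suc intro!: cm_upto_add)
qed (simp add: cm_upto_0)

lemma cm_upto_sum: "(\<And>i. i \<in> I \<Longrightarrow> cm_upto N (f i)) \<Longrightarrow> cm_upto N (\<lambda>m. \<Sum>i\<in>I. f i m)"
  by (simp add: cm_upto_def bdiff_pow_sum sum_nonneg)

lemma cm_upto_prod: "(\<And>i. i \<in> I \<Longrightarrow> cm_upto N (f i)) \<Longrightarrow> cm_upto N (\<lambda>m. \<Prod>i\<in>I. f i m)"
  by (induction I rule: infinite_finite_induct) (auto intro: cm_upto_mult cm_upto_const)

text \<open>The difference of \<open>1 / c\<close> is the increment of \<open>c\<close> times two shifts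
of \<open>1 / c\<close> itself, so the order of complete monotonicity of
\<open>1 / c\<close> can be raised step by step.\<close>

lemma cm_upto_inverse:
  fixes c :: "nat \<Rightarrow> real"
  assumes pos: "\<And>m. 0 < c m" and cm: "\<And>N. cm_upto N (\<lambda>m. c (Suc m) - c m)"
  shows "cm_upto N (\<lambda>m. 1 / c m)"
proof (induction N)
  case (Suc N)
  have "bdiff (\<lambda>m. 1 / c m) = (\<lambda>m. (c (Suc m) - c m) * (1 / c m * (1 / c (Suc m))))"
    using pos by (auto simp: bdiff_def field_simps fun_eq_iff less_imp_neq[symmetric])
  moreover have "cm_upto N \<dots>"
    using Suc cm cm_upto_shift[of N "\<lambda>m. 1 / c m"] by (intro cm_upto_mult) auto
  ultimately show ?case
    using pos by (auto simp: cm_upto_Suc less_imp_le)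
qed (use pos in \<open>auto simp: cm_upto_0 less_imp_le\<close>)

lemma cm_upto_inverse_linear: "0 < a \<Longrightarrow> cm_upto N (\<lambda>m. 1 / (real m + a))"
  by (rule cm_upto_inverse) (auto intro: cm_upto_const)

text \<open>Differences in the second variable turn \<open>1 / (C + n)\<close> into a product of factors
\<open>1 / (C + n + i)\<close>, each the reciprocal of a sequence with the same increments
as \<open>C\<close>.\<close>

lemma joint_completely_monotone_inverse:
  fixes A C :: "nat \<Rightarrow> real"
  assumes A: "\<And>N. cm_upto N (\<lambda>m. 1 / A m)"
    and C: "\<And>m. 0 < C m" "\<And>N. cm_upto N (\<lambda>m. C (Suc m) - C m)"
  shows "joint_completely_monotone (\<lambda>m n. 1 / (A m * (C m + real n)))"
proof -
  have "0 \<le> (bdiff ^^ i) (\<lambda>m. (bdiff ^^ j) (\<lambda>n. 1 / (A m * (C m + real n))) n) m" for i j m n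
  proof -
    have "(\<lambda>m. (bdiff ^^ j) (\<lambda>n. 1 / (A m * (C m + real n))) n)
        = (\<lambda>m. 1 / A m * (fact j * (\<Prod>i\<in>{0..<Suc j}. 1 / (C m + real n + real i))))"
    proof
      fix m
      have "(bdiff ^^ j) (\<lambda>n. 1 / (A m * (C m + real n))) n
          = (bdiff ^^ j) (\<lambda>n. 1 / A m * (1 / (C m + real n))) n" by simp
      also have "\<dots> = 1 / A m * (fact j / pochhammer (C m + real n) (Suc j))"
        by (simp only: bdiff_pow_cmult bdiff_pow_inverse_linear C)
      also have "\<dots> = 1 / A m * (fact j * (\<Prod>i\<in>{0..<Suc j}. 1 / (C m + real n + real i)))"
        by (simp only: pochhammer_prod prod_dividef prod.neutral_const) simp
      finally show "(bdiff ^^ j) (\<lambda>n. 1 / (A m * (C m + real n))) n = \<dots>" .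
    qed
    moreover have "cm_upto i (\<lambda>m. 1 / (C m + real n + real q))" for q
      using C by (intro cm_upto_inverse) (simp_all add: add_pos_nonneg)
    then have "cm_upto i (\<lambda>m. 1 / A m * (fact j * (\<Prod>q\<in>{0..<Suc j}. 1 / (C m + real n + real q))))"
      by (intro cm_upto_mult A cm_upto_const cm_upto_prod) auto
    ultimately show ?thesis by (simp add: cm_upto_def)
  qed
  then show ?thesis by (simp add: joint_completely_monotone_iff)
qed

section \<open>Quotients of polynomials with interlacing zeros\<close>

text \<open>Induction on the number of poles, adding the leftmost one, \<open>- t\<close>, last. The new
factor is \<open>1 + d / (x + t)\<close> with \<open>d \<ge> 0\<close>. Multiplying by it
adds the nonnegative amount \<open>d * r j / (t - a j)\<close> to each old coefficient, and
the new coefficient is \<open>- d\<close> times the old quotient at \<open>- t\<close>. The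
latter is nonpositive: at \<open>- t\<close> every factor of the old numerator and
denominator is nonpositive, and the numerator has one factor more.\<close>

lemma interlacing_partial_fractions:
  fixes a b :: "nat \<Rightarrow> real"
  assumes "\<forall>j\<in>{1..l}. b j \<le> a j \<and> a j \<le> b (j + 1)" and "inj_on a {1..l}"
  shows "\<exists>c r. (\<forall>j\<in>{1..l}. 0 \<le> r j) \<and>
     (\<forall>x. (\<forall>j\<in>{1..l}. x + a j \<noteq> 0) \<longrightarrow>
        (\<Prod>j=1..Suc l. x + b j) / (\<Prod>j=1..l. x + a j) = x + c - (\<Sum>j=1..l. r j / (x + a j)))"
  using assms
proof (induction l)
  case 0
  show ?case by (intro exI[of _ "b 1"]) simp
next
  case (Suc l)
  from Suc.prems have "\<forall>j\<in>{1..l}. b j \<le> a j \<and> a j \<le> b (j + 1)" "inj_on a {1..l}"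
    by (auto intro: inj_on_subset)
  from Suc.IH[OF this] obtain c r where r: "\<forall>j\<in>{1..l}. 0 \<le> r j" and
    pf: "\<And>x. (\<forall>j\<in>{1..l}. x + a j \<noteq> 0) \<Longrightarrow>
        (\<Prod>j=1..Suc l. x + b j) / (\<Prod>j=1..l. x + a j) = x + c - (\<Sum>j=1..l. r j / (x + a j))"
    by blast
  define t where "t = a (Suc l)"
  define d where "d = b (Suc (Suc l)) - t"
  \<comment> \<open>the old quotient at \<open>- t\<close>\<close>
  define F where "F = - t + c - (\<Sum>j=1..l. r j / (- t + a j))"
  have d: "0 \<le> d" using Suc.prems(1) by (auto simp: d_def t_def)
  have le: "a j \<le> t" if "1 \<le> j" "j \<le> Suc l" for j
    using that(2,1)
  proof (induction j rule: inc_induct)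
    case (step n)
    have "a n \<le> b (n + 1)" "b (n + 1) \<le> a (n + 1)"
      using step Suc.prems(1) by auto
    with step show ?case by simp
  qed (simp add: t_def)
  have lt: "a j < t" if "j \<in> {1..l}" for j
  proof -
    have "a j \<noteq> t" using that Suc.prems(2) unfolding t_def inj_on_def by force
    with le[of j] that show ?thesis by auto
  qed
  have ble: "b j \<le> t" if "j \<in> {1..Suc l}" for j
  proof -
    have "b j \<le> a j" using Suc.prems(1) that by auto
    with le[of j] that show ?thesis by auto
  qed
  have "F = (\<Prod>j=1..Suc l. - t + b j) / (\<Prod>j=1..l. - t + a j)"
    unfolding F_def by (rule pf[symmetric]) (use lt in force)
  also have "\<dots> = (\<Prod>j=1..l. (- t + b j) / (- t + a j)) * (- t + b (Suc l))"
    by (simp add: prod_dividef)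
  also have "\<dots> \<le> 0"
  proof (rule mult_nonneg_nonpos)
    show "0 \<le> (\<Prod>j=1..l. (- t + b j) / (- t + a j))"
    proof (intro prod_nonneg ballI)
      fix j assume "j \<in> {1..l}"
      then show "0 \<le> (- t + b j) / (- t + a j)" using ble[of j] lt[of j] 
        by (intro divide_nonpos_neg) auto
    qed
  qed (use ble in auto)
  finally have F: "F \<le> 0" .
  define r' where "r' j = (if j \<le> l then r j + d * (r j / (t - a j)) else - d * F)" for j
  have sum': "(\<Sum>j=1..Suc l. r' j / (x + a j))
      = (\<Sum>j=1..l. (r j + d * (r j / (t - a j))) / (x + a j)) - d * F / (x + t)" for x
    by (simp add: r'_def t_def)
  show ?case
  proof (intro exI conjI allI impI ballI)
    fix j assume "j \<in> {1..Suc l}"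
    show "0 \<le> r' j"
    proof (cases "j \<le> l")
      case True
      then have "0 \<le> r j" "a j < t" using r lt \<open>j \<in> _\<close> by auto
      then show ?thesis using d True by (simp add: r'_def)
    next
      case False
      then show ?thesis using d F by (simp add: r'_def mult_nonneg_nonpos)
    qed
  next
    fix x assume nz: "\<forall>j\<in>{1..Suc l}. x + a j \<noteq> 0"
    then have xt: "x + t \<noteq> 0" by (auto simp: t_def)
    define S where "S = (\<Sum>j=1..l. r j / (x + a j))"
    define S' where "S' = (\<Sum>j=1..l. (r j / (t - a j)) / (x + a j))"
    define R where "R = (\<Sum>j=1..l. r j / (t - a j))"
    have FR: "F = - t + c + R"
    proof -
      have "r j / (- t + a j) = - (r j / (t - a j))" for j
        by (simp flip: divide_minus_right)
      then show ?thesis by (simp add: F_def R_def sum_negf)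
    qed
    have SR: "S / (x + t) = S' - R / (x + t)"
    proof -
      have "r j / (x + a j) / (x + t) = r j / (t - a j) / (x + a j) - r j / (t - a j) / (x + t)"
        if "j \<in> {1..l}" for j
      proof -
        have "x + a j \<noteq> 0" "t - a j \<noteq> 0" using nz lt[OF that] that by auto
        then show ?thesis using xt by (simp add: divide_simps) (simp add: algebra_simps)
      qed
      then show ?thesis
        by (simp add: S_def S'_def R_def sum_divide_distrib sum_subtractf)
    qed
    have "(\<Prod>j=1..Suc (Suc l). x + b j) / (\<Prod>j=1..Suc l. x + a j)
        = (\<Prod>j=1..Suc l. x + b j) / (\<Prod>j=1..l. x + a j) * ((x + b (Suc (Suc l))) / (x + t))"
      by (simp add: t_def)
    also have "\<dots> = (x + c - S) * ((x + b (Suc (Suc l))) / (x + t))"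
      using nz by (subst pf) (auto simp: S_def)
    also have "(x + b (Suc (Suc l))) / (x + t) = 1 + d / (x + t)"
      using xt by (simp add: d_def divide_simps)
    also have "(x + c - S) * (1 + d / (x + t)) = x + c - S + d * ((x + c) / (x + t) - S / (x + t))"
      by (simp add: algebra_simps diff_divide_distrib)
    also have "(x + c) / (x + t) = 1 + (c - t) / (x + t)"
      using xt by (simp add: divide_simps)
    also have "x + c - S + d * (1 + (c - t) / (x + t) - S / (x + t))
       = x + (c + d) - (S + d * S') + d * F / (x + t)"
      unfolding SR FR by (simp add: algebra_simps add_divide_distrib diff_divide_distrib)
    also have "S + d * S' = (\<Sum>j=1..l. (r j + d * (r j / (t - a j))) / (x + a j))"
      by (simp add: S_def S'_def sum_distrib_left sum.distrib add_divide_distrib)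
    finally show "(\<Prod>j=1..Suc (Suc l). x + b j) / (\<Prod>j=1..Suc l. x + a j)
        = x + (c + d) - (\<Sum>j=1..Suc l. r' j / (x + a j))"
      unfolding sum' by simp
  qed
qed

text \<open>After partial fractions the increment is a nonnegative combination of the constant
\<open>1\<close> and products \<open>1 / (m + a j) * (1 / (m + 1 + a j))\<close>.\<close>

lemma interlacing_quotient_increment_cm:
  fixes a b :: "nat \<Rightarrow> real"
  assumes "\<forall>j\<in>{1..l}. b j \<le> a j \<and> a j \<le> b (j + 1)" and "inj_on a {1..l}"
    and pos: "\<And>j. j \<in> {1..l} \<Longrightarrow> 0 < a j"
  defines "q \<equiv> \<lambda>x. (\<Prod>j=1..Suc l. x + b j) / (\<Prod>j=1..l. x + a j)"
  shows "cm_upto N (\<lambda>m. q (real (Suc m)) - q (real m))"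
proof -
  from interlacing_partial_fractions[OF assms(1,2)] obtain c r where r: "\<forall>j\<in>{1..l}. 0 \<le> r j" and
    pf: "\<And>x. (\<forall>j\<in>{1..l}. x + a j \<noteq> 0) \<Longrightarrow> q x = x + c - (\<Sum>j=1..l. r j / (x + a j))"
    unfolding q_def by blast
  have "q (real (Suc m)) - q (real m)
      = 1 + (\<Sum>j=1..l. r j * (1 / (real m + a j) * (1 / (real (Suc m) + a j))))" for m
  proof -
    have "r j / (real m + a j) - r j / (real (Suc m) + a j)
        = r j * (1 / (real m + a j) * (1 / (real (Suc m) + a j)))" if "j \<in> {1..l}" for j
    proof -
      have "real m + a j > 0" "real (Suc m) + a j > 0" using pos[OF that] by auto
      then show ?thesis by (simp add: divide_simps) (simp add: algebra_simps)
    qed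
    then have incr: "(\<Sum>j=1..l. r j / (real m + a j)) - (\<Sum>j=1..l. r j / (real (Suc m) + a j))
        = (\<Sum>j=1..l. r j * (1 / (real m + a j) * (1 / (real (Suc m) + a j))))"
      by (simp flip: sum_subtractf)
    have "q (real i) = real i + c - (\<Sum>j=1..l. r j / (real i + a j))" for i
      by (rule pf) (use pos in \<open>force simp: add_nonneg_eq_0_iff\<close>)
    from this[of m] this[of "Suc m"] incr of_nat_Suc[of m, where 'a = real] show ?thesis by linarith
  qed
  moreover have "cm_upto N (\<lambda>m. 1 + (\<Sum>j=1..l. r j * (1 / (real m + a j) * (1 / (real (Suc m) + a j)))))"
    using r pos cm_upto_shift[OF cm_upto_inverse_linear]
    by (intro cm_upto_add cm_upto_sum cm_upto_mult cm_upto_const cm_upto_inverse_linear) auto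
  ultimately show ?thesis by (simp only:)
qed

lemma interlacing_imp_joint_completely_monotone:
  fixes a b :: "nat \<Rightarrow> real"
  assumes a: "\<And>j. j \<in> {0..l} \<Longrightarrow> 0 < a j" and b: "\<And>j. j \<in> {0..Suc l} \<Longrightarrow> 0 < b j"
    and inj: "inj_on a {1..l}"
    and inter: "\<forall>j\<in>{1..l}. b j \<le> a j \<and> a j \<le> b (j + 1)"
  shows "joint_completely_monotone (\<lambda>m n. 1 /
    (b 0 * (\<Prod>j=1..Suc l. real m + b j) + a 0 * (\<Prod>j=1..l. real m + a j) * real n))"
proof -
  define A where "A m = a 0 * (\<Prod>j=1..l. real m + a j)" for m
  define q where "q x = (\<Prod>j=1..Suc l. x + b j) / (\<Prod>j=1..l. x + a j)" for x :: real
  define C where "C m = b 0 / a 0 * q (real m)" for m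
  have a0: "0 < a 0" and b0: "0 < b 0" using a b by auto
  have a1: "0 < a j" if "j \<in> {1..l}" for j using a[of j] that by simp
  have PA: "0 < (\<Prod>j=1..l. real m + a j)" for m
    using a by (intro prod_pos) (auto intro: add_nonneg_pos)
  have PB: "0 < (\<Prod>j=1..Suc l. real m + b j)" for m
    using b by (intro prod_pos) (auto intro: add_nonneg_pos)
  have C: "0 < C m" for m
    unfolding C_def q_def using a0 b0 PA PB by (intro mult_pos_pos divide_pos_pos)
  have "cm_upto N (\<lambda>m. 1 / A m)" for N
  proof -
    have "(\<lambda>m. 1 / A m) = (\<lambda>m. 1 / a 0 * (\<Prod>j=1..l. 1 / (real m + a j)))"
      by (simp add: A_def prod_dividef)
    moreover have "cm_upto N \<dots>"
      using a0 a1 by (intro cm_upto_mult cm_upto_const cm_upto_prod cm_upto_inverse_linear) auto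
    ultimately show ?thesis by (simp only:)
  qed
  moreover have "cm_upto N (\<lambda>m. C (Suc m) - C m)" for N
  proof -
    have "cm_upto N (\<lambda>m. b 0 / a 0 * (q (real (Suc m)) - q (real m)))"
      unfolding q_def
      by (intro cm_upto_mult cm_upto_const interlacing_quotient_increment_cm[OF inter inj] a1)
         (use a0 b0 in simp)
    then show ?thesis by (simp only: C_def right_diff_distrib)
  qed
  ultimately have "joint_completely_monotone (\<lambda>m n. 1 / (A m * (C m + real n)))"
    using C by (intro joint_completely_monotone_inverse)
  moreover have "A m * (C m + real n) = b 0 * (\<Prod>j=1..Suc l. real m + b j) + A m * real n" for m n
  proof -
    have "A m * C m = b 0 * (\<Prod>j=1..Suc l. real m + b j)"
    proof -
      have cancel: "x * y * (c / x * (d / y)) = c * d" if "x \<noteq> 0" "y \<noteq> 0" for x y c d :: real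
        using that by simp
      show ?thesis
        unfolding A_def C_def q_def
        by (rule cancel[OF less_imp_neq[OF a0, symmetric] less_imp_neq[OF PA, symmetric]])
    qed
    then show ?thesis by (simp only: distrib_left)
  qed
  ultimately show ?thesis by (simp only: A_def)
qed

section \<open>Logarithmic convexity and the degree gap\<close>

text \<open>The binomial expansion of \<open>(E + D)^M\<close> applied to \<open>f\<close> at
\<open>r\<close>, where \<open>E\<close> is the shift and \<open>D\<close> the backward
difference, so that \<open>E + D\<close> is the identity. For a completely monotone sequence
it represents \<open>f r\<close> by nonnegative quantities.\<close>

lemma bernstein_expansion:
  fixes f :: "nat \<Rightarrow> 'a::comm_ring_1"
  shows "f r = (\<Sum>i\<le>M. of_nat (M choose i) * (bdiff ^^ i) f (r + M - i))"
proof (induction M)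
  case (Suc M)
  define D where "D i q = (bdiff ^^ i) f q" for i q
  have D: "D i q = D (Suc i) q + D i (Suc q)" for i q
    by (simp only: D_def bdiff_pow_Suc) simp
  have "f r = (\<Sum>i\<le>M. of_nat (M choose i) * D i (r + M - i))"
    using Suc by (simp add: D_def)
  also have "\<dots> = (\<Sum>i\<le>M. of_nat (M choose i) * D (Suc i) (r + Suc M - Suc i))
                + (\<Sum>i\<le>M. of_nat (M choose i) * D i (r + Suc M - i))"
    unfolding sum.distrib[symmetric]
  proof (rule sum.cong)
    fix i assume "i \<in> {..M}"
    then show "of_nat (M choose i) * D i (r + M - i) = of_nat (M choose i) * D (Suc i) (r + Suc M - Suc i)
       + of_nat (M choose i) * D i (r + Suc M - i)"
      using D[of i "r + M - i"] by (simp add: Suc_diff_le algebra_simps)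
  qed simp
  also have "(\<Sum>i\<le>M. of_nat (M choose i) * D i (r + Suc M - i))
           = (\<Sum>i\<le>Suc M. of_nat (M choose i) * D i (r + Suc M - i))"
    by (simp add: binomial_eq_0)
  also have "\<dots> = D 0 (r + Suc M) + (\<Sum>i\<le>M. of_nat (M choose Suc i) * D (Suc i) (r + Suc M - Suc i))"
    by (subst sum.atMost_Suc_shift) simp
  also have "(\<Sum>i\<le>M. of_nat (M choose i) * D (Suc i) (r + Suc M - Suc i)) +
     (D 0 (r + Suc M) + (\<Sum>i\<le>M. of_nat (M choose Suc i) * D (Suc i) (r + Suc M - Suc i)))
     = D 0 (r + Suc M) + (\<Sum>i\<le>M. of_nat (Suc M choose Suc i) * D (Suc i) (r + Suc M - Suc i))"
    by (simp add: sum.distrib distrib_right)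
  also have "\<dots> = (\<Sum>i\<le>Suc M. of_nat (Suc M choose i) * D i (r + Suc M - i))"
    by (subst sum.atMost_Suc_shift) simp
  finally show ?case by (simp only: D_def)
qed simp

text \<open>If \<open>f m\<close> is the \<open>m\<close>-th moment of a positive measure on the unit
interval, the quantity is the integral of the square \<open>(1 - t s)\<^sup>2\<close>. The
measure is replaced by its discrete approximation on the points
\<open>s i = (N - i) / N\<close> with weights \<open>w i\<close>: by the Bernstein
expansions of \<open>f 0\<close>, \<open>f 1\<close> and \<open>f 2\<close>, which all refer
to the same values \<open>(bdiff ^^ i) f (N - i)\<close>, the moments of orders
\<open>0\<close> and \<open>1\<close> are exact, and that of order \<open>2\<close> is exact
up to an error that is bounded by \<open>f 0 / (N - 1)\<close>.\<close>

lemma cm_quadratic_nonneg: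
  fixes f :: "nat \<Rightarrow> real"
  assumes cm: "\<And>j m. 0 \<le> (bdiff ^^ j) f m"
  shows "0 \<le> f 0 - 2 * t * f 1 + t\<^sup>2 * f 2"
proof -
  have lower: "- (t\<^sup>2 * f 0) / real (Suc M) \<le> f 0 - 2 * t * f 1 + t\<^sup>2 * f 2" for M
  proof -
    define N where "N = M + 2"
    define w where "w i = real (N choose i) * (bdiff ^^ i) f (N - i)" for i
    define s where "s i = (real N - real i) / real N" for i
    have w: "0 \<le> w i" for i using cm by (simp add: w_def)
    have f0: "f 0 = (\<Sum>i\<le>N. w i)"
      using bernstein_expansion[of f 0 N] by (simp add: w_def)
    have c1: "real (Suc M choose i) = real (N choose i) * s i" if "i \<le> N" for i
    proof -
      have "real (N - i) * real (N choose i) = real N * real ((N - 1) choose i)"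
        using binomial_absorb_comp[of N i] by (metis of_nat_mult)
      moreover have "N - 1 = Suc M" by (simp add: N_def)
      moreover have "real (N - i) = real N - real i" using that by (rule of_nat_diff)
      moreover have "real N \<noteq> 0" by (simp add: N_def)
      ultimately show ?thesis by (simp add: s_def field_simps)
    qed
    have f1: "f 1 = (\<Sum>i\<le>N. s i * w i)"
    proof -
      have "f 1 = (\<Sum>i\<le>Suc M. real (Suc M choose i) * (bdiff ^^ i) f (N - i))"
        using bernstein_expansion[of f 1 "Suc M"] by (simp add: N_def)
      also have "\<dots> = (\<Sum>i\<le>N. real (Suc M choose i) * (bdiff ^^ i) f (N - i))"
        by (simp add: N_def binomial_eq_0)
      finally show ?thesis by (simp add: c1 w_def mult_ac)
    qed
    \<comment> \<open>\<open>(N - i - 1) / (N - 1)\<close> falls short of \<open>s i\<close> by \<open>(1 - s i) / (N - 1)\<close>, where \<open>N - 1 = Suc M\<close>.\<close>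
    have c2: "real (M choose i) = real (N choose i) * (s i * (s i - (1 - s i) / real (Suc M)))"
      if "i \<le> N" for i
    proof (cases "i = N")
      case False
      then have "real (Suc M - i) * real (Suc M choose i) = real (Suc M) * real (M choose i)"
        using binomial_absorb_comp[of "Suc M" i] by (metis diff_Suc_1 of_nat_mult)
      moreover have "real (Suc M - i) = real (Suc M) - real i"
        using False that by (intro of_nat_diff) (simp add: N_def)
      ultimately have "real (M choose i) = real (Suc M choose i) * ((real (Suc M) - real i) / real (Suc M))"
        by (simp add: field_simps)
      moreover have "(real (Suc M) - real i) / real (Suc M) = s i - (1 - s i) / real (Suc M)"
        by (simp add: s_def N_def divide_simps) (simp add: algebra_simps)
      ultimately show ?thesis by (simp only: c1[OF that] mult.assoc)
    qed (simp add: N_def s_def)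
    have f2: "f 2 = (\<Sum>i\<le>N. s i * (s i - (1 - s i) / real (Suc M)) * w i)"
    proof -
      have "f 2 = (\<Sum>i\<le>M. real (M choose i) * (bdiff ^^ i) f (N - i))"
        using bernstein_expansion[of f 2 M] by (simp add: N_def add.commute)
      also have "\<dots> = (\<Sum>i\<le>N. real (M choose i) * (bdiff ^^ i) f (N - i))"
        by (simp add: N_def binomial_eq_0)
      finally show ?thesis by (simp add: c2 w_def mult_ac)
    qed
    have "- (t\<^sup>2 * f 0) / real (Suc M) = (\<Sum>i\<le>N. - (t\<^sup>2 / real (Suc M)) * w i)"
      unfolding f0 sum_distrib_left[symmetric] by simp
    also have "\<dots> \<le> (\<Sum>i\<le>N. (1 - 2 * t * s i + t\<^sup>2 * (s i * (s i - (1 - s i) / real (Suc M)))) * w i)"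
    proof (intro sum_mono mult_right_mono w)
      fix i assume i: "i \<in> {..N}"
      have s: "0 \<le> s i" "s i \<le> 1" using i by (auto simp: s_def N_def)
      have "s i * (1 - s i) \<le> 1" using s by (simp add: mult_le_one)
      then have "t\<^sup>2 * (s i * (1 - s i) / real (Suc M)) \<le> t\<^sup>2 * (1 / real (Suc M))"
        by (intro mult_left_mono divide_right_mono) auto
      then have "0 - t\<^sup>2 * (1 / real (Suc M)) \<le> (1 - t * s i)\<^sup>2 - t\<^sup>2 * (s i * (1 - s i) / real (Suc M))"
        by (intro diff_mono zero_le_power2)
      also have "\<dots> = 1 - 2 * t * s i + t\<^sup>2 * (s i * (s i - (1 - s i) / real (Suc M)))"
        by (simp add: power2_eq_square algebra_simps)
      finally show "- (t\<^sup>2 / real (Suc M)) \<le> 1 - 2 * t * s i + t\<^sup>2 * (s i * (s i - (1 - s i) / real (Suc M)))"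
        by simp
    qed
    also have "\<dots> = f 0 - 2 * t * f 1 + t\<^sup>2 * f 2"
      unfolding f0 f1 f2 by (simp add: sum_distrib_left sum.distrib sum_subtractf algebra_simps)
    finally show ?thesis .
  qed
  have "(\<lambda>M. - (t\<^sup>2 * f 0) / real (Suc M)) \<longlonglongrightarrow> 0"
    using LIMSEQ_Suc[OF lim_const_over_n[of "- (t\<^sup>2 * f 0)"]] by simp
  then show ?thesis
    by (rule LIMSEQ_le_const2) (use lower in blast)
qed

lemma cm_log_convex:
  fixes f :: "nat \<Rightarrow> real"
  assumes cm: "\<And>j m. 0 \<le> (bdiff ^^ j) f m"
  shows "(f (m + 1))\<^sup>2 \<le> f m * f (m + 2)"
proof -
  define g where "g i = f (i + m)" for i
  have Q: "0 \<le> g 0 - 2 * t * g 1 + t\<^sup>2 * g 2" for t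
    by (rule cm_quadratic_nonneg) (simp only: g_def bdiff_pow_shift cm)
  have g: "0 \<le> g 0" "0 \<le> g 1" "0 \<le> g 2" using cm[of 0] by (simp_all add: g_def)
  have "(g 1)\<^sup>2 \<le> g 0 * g 2"
  proof (cases "g 2 = 0")
    case True
    have "g 1 = 0"
    proof (rule ccontr)
      assume "g 1 \<noteq> 0"
      \<comment> \<open>With \<open>g 2 = 0\<close> the quadratic is affine; this \<open>t\<close> makes it \<open>- g 0 - 2\<close>.\<close>
      then show False using Q[of "(g 0 + 1) / g 1"] True g by simp
    qed
    then show ?thesis using True by simp
  next
    case False
    then have "0 \<le> g 0 - (g 1)\<^sup>2 / g 2"
      using Q[of "g 1 / g 2"] by (simp add: power2_eq_square)
    then show ?thesis using False g by (simp add: field_simps)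
  qed
  then show ?thesis by (simp add: g_def add.commute)
qed

text \<open>Euler's product for the Gamma function gives the growth rate \<open>j powr (- z)\<close> of
the left-hand side together with its constant \<open>Gamma z\<close>.\<close>

lemma fact_over_pochhammer_conv_Gamma_series:
  fixes z :: real
  assumes "0 < j"
  shows "fact j / pochhammer z (Suc j) = Gamma_series z j * exp (- (z * ln (real j)))"
  by (simp add: Gamma_series_def exp_minus)

lemma exp_neg_ln_tendsto_0: "0 < s \<Longrightarrow> (\<lambda>j. exp (- (s * ln (real j)))) \<longlonglongrightarrow> 0"
  by real_asymp

lemma fact_over_pochhammer_tendsto_0:
  fixes s :: real
  assumes "0 < s"
  shows "(\<lambda>j. fact j / pochhammer s (Suc j)) \<longlonglongrightarrow> 0"
proof -
  have "(\<lambda>j. Gamma_series s j * exp (- (s * ln (real j)))) \<longlonglongrightarrow> Gamma s * 0"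
    by (intro tendsto_mult Gamma_series_LIMSEQ exp_neg_ln_tendsto_0 assms)
  then have "(\<lambda>j. Gamma_series s j * exp (- (s * ln (real j)))) \<longlonglongrightarrow> 0" by simp
  moreover have "\<forall>\<^sub>F j in sequentially. Gamma_series s j * exp (- (s * ln (real j))) = fact j / pochhammer s (Suc j)"
    using eventually_gt_at_top[of "0::nat"]
    by eventually_elim (rule fact_over_pochhammer_conv_Gamma_series[symmetric])
  ultimately show ?thesis by (rule Lim_transform_eventually)
qed

text \<open>Logarithmic convexity in \<open>m\<close> of the kernels, which behave like
\<open>Gamma (C m) / A m * j powr (- C m)\<close>, is incompatible with a positive second
difference \<open>s\<close> of \<open>C\<close>: after division by the powers of
\<open>j\<close> one side tends to a positive limit and the other carries a factor
\<open>j powr (- s)\<close>.\<close>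

lemma concave_of_log_convex_kernels:
  fixes A C :: "nat \<Rightarrow> real"
  assumes A: "\<And>m. 0 < A m" and C: "\<And>m. 0 < C m"
    and cm: "\<And>i j m. 0 \<le> (bdiff ^^ i) (\<lambda>m. 1 / A m * (fact j / pochhammer (C m) (Suc j))) m"
  shows "C m + C (m + 2) \<le> 2 * C (m + 1)"
proof (rule ccontr)
  assume *: "\<not> ?thesis"
  \<comment> \<open>the second difference of \<open>C\<close>, assumed positive\<close>
  define s where "s = C m + C (m + 2) - 2 * C (m + 1)"
  have s: "0 < s" using * by (simp add: s_def)
  have "(Gamma_series (C (m + 1)) j / A (m + 1))\<^sup>2
      \<le> Gamma_series (C m) j / A m * (Gamma_series (C (m + 2)) j / A (m + 2)) * exp (- (s * ln (real j)))"
    if j: "0 < j" for j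
  proof -
    define L where "L = ln (real j)"
    define G where "G i = Gamma_series (C i) j / A i" for i
    have "(G (m + 1) * exp (- (C (m + 1) * L)))\<^sup>2 
       \<le> (G m * exp (- (C m * L))) * (G (m + 2) * exp (- (C (m + 2) * L)))"
      using cm_log_convex[OF cm, of m j] j
      by (simp only: fact_over_pochhammer_conv_Gamma_series) (simp add: G_def L_def)
    also have "\<dots> = G m * G (m + 2) * exp (- (s * L)) * exp (- (2 * C (m + 1) * L))"
      by (simp add: s_def algebra_simps flip: exp_add)
    also have "(G (m + 1) * exp (- (C (m + 1) * L)))\<^sup>2 = (G (m + 1))\<^sup>2 * exp (- (2 * C (m + 1) * L))"
      by (simp add: power_mult_distrib flip: exp_double)
    finally have "(G (m + 1))\<^sup>2 \<le> G m * G (m + 2) * exp (- (s * L))"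
      by (simp only: mult_le_cancel_right_pos[OF exp_gt_zero])
    then show ?thesis by (simp only: G_def L_def)
  qed
  then have "\<forall>j\<ge>1. (Gamma_series (C (m + 1)) j / A (m + 1))\<^sup>2
      \<le> Gamma_series (C m) j / A m * (Gamma_series (C (m + 2)) j / A (m + 2)) * exp (- (s * ln (real j)))"
    by auto
  moreover have "(\<lambda>j. (Gamma_series (C (m + 1)) j / A (m + 1))\<^sup>2) \<longlonglongrightarrow> (Gamma (C (m + 1)) / A (m + 1))\<^sup>2"
    using A[of "m + 1"] by (intro tendsto_intros) auto
  moreover have "(\<lambda>j. Gamma_series (C m) j / A m * (Gamma_series (C (m + 2)) j / A (m + 2)) * exp (- (s * ln (real j))))
      \<longlonglongrightarrow> Gamma (C m) / A m * (Gamma (C (m + 2)) / A (m + 2)) * 0"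
    using A[of m] A[of "m + 2"] by (intro tendsto_intros exp_neg_ln_tendsto_0 s) auto
  ultimately have "(Gamma (C (m + 1)) / A (m + 1))\<^sup>2 \<le> 0"
    using LIMSEQ_le by (metis (no_types, lifting) mult_zero_right)
  moreover have "0 < Gamma (C (m + 1)) / A (m + 1)" using A C by (simp add: Gamma_real_pos)
  ultimately show False by auto
qed

lemma concave_sequence_le_linear:
  fixes C :: "nat \<Rightarrow> real"
  assumes "\<And>m. C m + C (m + 2) \<le> 2 * C (m + 1)"
  shows "C m \<le> C 0 + real m * (C 1 - C 0)"
proof -
  have step: "C (Suc m) - C m \<le> C 1 - C 0" for m
  proof (induction m)
    case (Suc m)
    then show ?case using assms[of m] by simp
  qed simp
  show ?thesis
  proof (induction m)
    case (Suc m)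
    then show ?case using step[of m] by (simp add: algebra_simps)
  qed simp
qed

lemma concave_not_superlinear:
  fixes C :: "nat \<Rightarrow> real"
  assumes conc: "\<And>m. C m + C (m + 2) \<le> 2 * C (m + 1)"
    and "0 < c" and low: "\<And>m. 1 \<le> m \<Longrightarrow> c * real m ^ 2 \<le> C m"
  shows False
proof -
  define D where "D = \<bar>C 0\<bar> + \<bar>C 1 - C 0\<bar>"
  obtain m where m: "D / c < real m" using reals_Archimedean2 by blast
  have "0 \<le> D / c" using \<open>0 < c\<close> by (simp add: D_def)
  with m have m1: "1 \<le> m" by linarith
  have "c * real m ^ 2 \<le> C 0 + real m * (C 1 - C 0)"
    using low[OF m1] concave_sequence_le_linear[OF conc, of m] by simp
  also have "\<dots> \<le> real m * \<bar>C 0\<bar> + real m * \<bar>C 1 - C 0\<bar>"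
  proof (rule add_mono)
    have "1 * \<bar>C 0\<bar> \<le> real m * \<bar>C 0\<bar>" using m1 by (intro mult_right_mono) auto
    then show "C 0 \<le> real m * \<bar>C 0\<bar>" by simp
  qed (simp add: mult_left_mono)
  finally have "real m * (c * real m) \<le> real m * D"
    by (simp add: D_def power2_eq_square algebra_simps)
  then have "c * real m \<le> D" using m1 by (simp only: mult_le_cancel_left_pos of_nat_0_less_iff)
  with m show False using \<open>0 < c\<close> by (simp add: field_simps)
qed

text \<open>Otherwise \<open>B / A\<close> grows at least quadratically, whereas the kernels at
\<open>n = 0\<close> force it to be concave.\<close>

lemma degree_gap_of_joint_completely_monotone:
  fixes a b :: "nat \<Rightarrow> real"
  assumes a: "\<And>j. j \<in> {0..l} \<Longrightarrow> 0 < a j" and b: "\<And>j. j \<in> {0..k} \<Longrightarrow> 0 < b j"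
    and jcm: "joint_completely_monotone (\<lambda>m n. 1 /
      (b 0 * (\<Prod>j=1..k. real m + b j) + a 0 * (\<Prod>j=1..l. real m + a j) * real n))"
  shows "k \<le> Suc l"
proof (rule ccontr)
  assume "\<not> k \<le> Suc l"
  then have kl: "l + 2 \<le> k" by simp
  define A where "A m = a 0 * (\<Prod>j=1..l. real m + a j)" for m
  define B where "B m = b 0 * (\<Prod>j=1..k. real m + b j)" for m
  define C where "C m = B m / A m" for m
  have a0: "0 < a 0" and b0: "0 < b 0" using a b by auto
  have A: "0 < A m" for m
    unfolding A_def using a by (intro mult_pos_pos prod_pos) (auto intro: add_nonneg_pos)
  have B: "0 < B m" for m
    unfolding B_def using b by (intro mult_pos_pos prod_pos) (auto intro: add_nonneg_pos)
  have C: "0 < C m" for m using A B by (simp add: C_def)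
  have kernel: "(bdiff ^^ j) (\<lambda>n. 1 / (B m + A m * real n)) 0
      = 1 / A m * (fact j / pochhammer (C m) (Suc j))" for j m
  proof -
    have "1 / (B m + A m * real n) = 1 / A m * (1 / (C m + real n))" for n
      using A[of m] by (simp add: C_def field_simps)
    then have "(bdiff ^^ j) (\<lambda>n. 1 / (B m + A m * real n)) 0
      = (bdiff ^^ j) (\<lambda>n. 1 / A m * (1 / (C m + real n))) 0" by simp
    also have "\<dots> = 1 / A m * (fact j / pochhammer (C m + real 0) (Suc j))"
      by (simp only: bdiff_pow_cmult bdiff_pow_inverse_linear[OF C])
    finally show ?thesis by (simp only: of_nat_0 add_0_right)
  qed
  have "0 \<le> (bdiff ^^ i) (\<lambda>m. (bdiff ^^ j) (\<lambda>n. 1 / (B m + A m * real n)) 0) m" for i j m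
    using jcm unfolding joint_completely_monotone_iff A_def B_def by blast
  then have conc: "C m + C (m + 2) \<le> 2 * C (m + 1)" for m
    unfolding kernel by (rule concave_of_log_convex_kernels[OF A C])
  \<comment> \<open>\<open>m + a j \<le> m * (1 + a j)\<close> for \<open>m \<ge> 1\<close>, so \<open>A m\<close> is at most a constant multiple of \<open>m ^ l\<close>.\<close>
  define Q where "Q = (\<Prod>j=1..l. 1 + a j)"
  have Q: "0 < Q" unfolding Q_def using a by (intro prod_pos) (auto intro: add_pos_pos)
  have "b 0 / (a 0 * Q) * real m ^ 2 \<le> C m" if m: "1 \<le> m" for m
  proof -
    have "(\<Prod>j=1..l. real m + a j) \<le> (\<Prod>j=1..l. real m * (1 + a j))"
    proof (rule prod_mono)
      fix j assume j: "j \<in> {1..l}"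
      have "1 * a j \<le> real m * a j" using m a[of j] j by (intro mult_right_mono) auto
      then show "0 \<le> real m + a j \<and> real m + a j \<le> real m * (1 + a j)"
        using a[of j] j by (simp add: distrib_left)
    qed
    then have "A m \<le> a 0 * (real m ^ l * Q)"
      unfolding A_def Q_def using a0 by (simp add: prod.distrib)
    moreover have "(\<Prod>j=1..k. real m) \<le> (\<Prod>j=1..k. real m + b j)"
      using b by (intro prod_mono) (auto intro: less_imp_le)
    then have "b 0 * real m ^ k \<le> B m" unfolding B_def using b0 by simp
    moreover have "real m ^ (l + 2) \<le> real m ^ k" using m kl by (intro power_increasing) auto
    then have "b 0 * real m ^ (l + 2) \<le> b 0 * real m ^ k" using b0 by simp
    ultimately have "b 0 * real m ^ (l + 2) / (a 0 * (real m ^ l * Q)) \<le> B m / A m"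
      using A[of m] B[of m] by (intro frac_le) (auto intro: order_trans)
    moreover have "b 0 * real m ^ (l + 2) / (a 0 * (real m ^ l * Q)) = b 0 / (a 0 * Q) * real m ^ 2"
      using m by (simp add: power_add power2_eq_square)
    ultimately show ?thesis by (simp only: C_def)
  qed
  then show False
    using concave_not_superlinear[OF conc, of "b 0 / (a 0 * Q)"] a0 b0 Q by simp
qed

section \<open>The slope at zero from Newton interpolation\<close>

text \<open>Partial sums of the formal series \<open>- f'(0) = - ln (1 + \<Delta>) f (0)\<close>: with
\<open>D = - \<Delta>\<close>, the logarithm expands to
\<open>(\<Sum>j\<ge>1. D^j f(0) / j)\<close>. Hence the limit to be expected is minus the
derivative.\<close>

definition newton_slope :: "(nat \<Rightarrow> 'a::real_normed_field) \<Rightarrow> nat \<Rightarrow> 'a" where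
  "newton_slope f J = (\<Sum>j<J. (bdiff ^^ Suc j) f 0 / of_nat (Suc j))"

text \<open>Up to an arbitrarily small offset \<open>h\<close>, which absorbs the perturbation
\<open>e\<close>, the sequence is dominated by a multiple of the solution
\<open>j! / pochhammer s (j + 1)\<close> of the unperturbed recursion, and this solution
tends to \<open>0\<close>.\<close>

lemma damped_recurrence_tendsto_0:
  fixes u e :: "nat \<Rightarrow> real"
  assumes s: "0 < s" and u: "\<And>j. 0 \<le> u j" and e: "e \<longlonglongrightarrow> 0"
    and rec: "\<And>j. u (Suc j) \<le> (real (Suc j) * u j + e j) / (real (Suc j) + s)"
  shows "u \<longlonglongrightarrow> 0"
proof (rule order_tendstoI)
  fix \<epsilon> :: real assume "0 < \<epsilon>"
  define h where "h = \<epsilon> / 2"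
  have h: "0 < h" using \<open>0 < \<epsilon>\<close> by (simp add: h_def)
  have "\<forall>\<^sub>F j in sequentially. e j < h * s"
    using order_tendstoD(2)[OF e, of "h * s"] h s by simp
  then obtain J where J: "\<And>j. j \<ge> J \<Longrightarrow> e j < h * s"
    by (auto simp: eventually_sequentially)
  define w where "w j = fact j / pochhammer s (Suc j)" for j
  have w: "0 < w j" for j using s by (simp add: w_def pochhammer_pos del: pochhammer_Suc)
  have w_Suc: "w (Suc j) = w j * (real (Suc j) / (real (Suc j) + s))" for j
    by (simp add: w_def pochhammer_Suc[of s "Suc j"] add_ac del: pochhammer_Suc)
  define K where "K = max 0 (u J - h) / w J"
  have bound: "u j \<le> h + K * w j" if "j \<ge> J" for j
    using that
  proof (induction j rule: dec_induct)
    case base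
    show ?case using w[of J] by (simp add: K_def)
  next
    case (step j)
    have p: "0 < real (Suc j) + s" using s by simp
    have "u (Suc j) \<le> (real (Suc j) * u j + e j) / (real (Suc j) + s)" by (rule rec)
    also have "\<dots> \<le> (real (Suc j) * (h + K * w j) + h * s) / (real (Suc j) + s)"
      using p step J[of j] by (intro divide_right_mono add_mono mult_left_mono) auto
    also have "\<dots> = h + K * w (Suc j)"
      using p by (simp add: w_Suc field_simps)
    finally show ?case .
  qed
  have lim: "(\<lambda>j. h + K * w j) \<longlonglongrightarrow> h + K * 0"
    using fact_over_pochhammer_tendsto_0[OF s] unfolding w_def by (intro tendsto_intros)
  have "\<forall>\<^sub>F j in sequentially. h + K * w j < \<epsilon>"
    by (rule order_tendstoD(2)[OF lim]) (use \<open>0 < \<epsilon>\<close> in \<open>simp add: h_def\<close>)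
  then show "\<forall>\<^sub>F j in sequentially. u j < \<epsilon>"
    using eventually_ge_at_top[of J] by eventually_elim (use bound in fastforce)
qed (use u in \<open>auto intro!: eventuallyI intro: less_le_trans\<close>)

text \<open>The limit is minus the derivative of \<open>1 / P\<close> at \<open>0\<close>. The proof
removes one root \<open>- \<rho>\<close> of \<open>P\<close> at a time, so multiple roots
need no special treatment. With \<open>P = (x + \<rho>) Q\<close>, \<open>f = 1 / P\<close>
and \<open>g = 1 / Q\<close>, the Leibniz rule for \<open>g = (x + \<rho>) f\<close>,
divided by the order of the difference and summed, telescopes to
  \<open>newton_slope g J = \<rho> * newton_slope f J + (bdiff ^^ J) f 0 - f 0\<close>,
in accordance with \<open>g' = (x + \<rho>) f' + f\<close> at \<open>0\<close>. The
remainder \<open>(bdiff ^^ J) f 0\<close> vanishes in the limit because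
\<open>\<rho>\<close> has positive real part; this is carried along in the induction.\<close>

lemma newton_slope_inverse_poly:
  fixes P :: "complex poly"
  assumes "\<And>z. poly P z = 0 \<Longrightarrow> Re z < 0"
  defines "f \<equiv> \<lambda>m. 1 / poly P (of_nat m)"
  shows "newton_slope f \<longlonglongrightarrow> poly (pderiv P) 0 / (poly P 0)\<^sup>2"
proof -
  have "(\<lambda>j. (bdiff ^^ Suc j) (\<lambda>m. 1 / poly P (of_nat m)) 0) \<longlonglongrightarrow> 0 \<and>
    newton_slope (\<lambda>m. 1 / poly P (of_nat m)) \<longlonglongrightarrow> poly (pderiv P) 0 / (poly P 0)\<^sup>2"
    using assms(1)
  proof (induction "degree P" arbitrary: P)
    case 0
    then obtain c where "P = [:c:]" using degree_eq_zeroE by metis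
    then show ?case
      using bdiff_pow_const[of "Suc _" "1 / c"] by (simp add: newton_slope_def[abs_def] del: funpow.simps)
  next
    case (Suc d)
    have "\<not> constant (poly P)" using Suc.hyps(2) by (simp add: constant_degree)
    then obtain z where z: "poly P z = 0" using fundamental_theorem_of_algebra by blast
    then obtain Q where PQ: "P = [:- z, 1:] * Q" by (metis dvdE poly_eq_0_iff_dvd)
    have P0: "P \<noteq> 0" using Suc.hyps(2) by auto
    then have "Q \<noteq> 0" using PQ by auto
    then have deg: "d = degree Q" using Suc.hyps(2) unfolding PQ by (subst (asm) degree_mult_eq) auto
    have Qroot: "Re w < 0" if "poly Q w = 0" for w using that Suc.prems[of w] PQ by simp
    define \<rho> where "\<rho> = - z"
    have \<rho>: "0 < Re \<rho>" using Suc.prems[OF z] by (simp add: \<rho>_def)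
    have \<rho>0: "\<rho> \<noteq> 0" using \<rho> by auto
    define f where "f m = 1 / poly P (of_nat m)" for m
    define g where "g m = 1 / poly Q (of_nat m)" for m
    have Pn: "poly P (of_nat m) \<noteq> 0" for m using Suc.prems[of "of_nat m"] by auto
    have g: "g = (\<lambda>m. (of_nat m + \<rho>) * f m)"
      using Pn by (auto simp: f_def g_def PQ \<rho>_def fun_eq_iff divide_simps algebra_simps)
    define p q where "p j = (bdiff ^^ j) f 0" and "q j = (bdiff ^^ j) g 0" for j
    have rec: "q (Suc j) = (\<rho> + of_nat (Suc j)) * p (Suc j) - of_nat (Suc j) * p j" for j
      unfolding p_def q_def g by (subst bdiff_pow_mult_linear) simp
    from Suc.hyps(1)[OF deg Qroot]
    have IH: "(\<lambda>j. q (Suc j)) \<longlonglongrightarrow> 0" "newton_slope g \<longlonglongrightarrow> poly (pderiv Q) 0 / (poly Q 0)\<^sup>2"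
      by (auto simp: q_def g_def[abs_def] simp del: funpow.simps)
    \<comment> \<open>Solving \<open>rec\<close> for \<open>p (Suc j)\<close> gives a damped recursion: the modulus of the divisor is
      at least \<open>Suc j + Re \<rho>\<close>.\<close>
    have "(\<lambda>j. norm (p j)) \<longlonglongrightarrow> 0"
    proof (rule damped_recurrence_tendsto_0[OF \<rho>])
      show "(\<lambda>j. norm (q (Suc j))) \<longlonglongrightarrow> 0" using IH(1) by (rule tendsto_norm_zero)
      fix j
      have le: "real (Suc j) + Re \<rho> \<le> norm (\<rho> + of_nat (Suc j))"
        using complex_Re_le_cmod[of "\<rho> + of_nat (Suc j)"] by simp
      have "(real (Suc j) + Re \<rho>) * norm (p (Suc j)) \<le> norm (\<rho> + of_nat (Suc j)) * norm (p (Suc j))"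
        by (intro mult_right_mono le) auto
      also have "\<dots> = norm (of_nat (Suc j) * p j + q (Suc j))"
        by (simp add: rec norm_mult[symmetric])
      also have "\<dots> \<le> real (Suc j) * norm (p j) + norm (q (Suc j))"
        by (rule norm_triangle_le) (simp add: norm_mult del: of_nat_Suc)
      finally show "norm (p (Suc j)) \<le> (real (Suc j) * norm (p j) + norm (q (Suc j))) / (real (Suc j) + Re \<rho>)"
        using \<rho> by (simp add: pos_le_divide_eq mult.commute)
    qed auto
    then have p0: "p \<longlonglongrightarrow> 0" by (rule tendsto_norm_zero_cancel)
    have slope: "newton_slope f J = (newton_slope g J + p 0 - p J) / \<rho>" for J
    proof -
      have "newton_slope g J = (\<Sum>j<J. \<rho> * (p (Suc j) / of_nat (Suc j)) + (p (Suc j) - p j))"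
        unfolding newton_slope_def q_def[symmetric] rec
        by (intro sum.cong) (simp_all add: field_simps del: of_nat_Suc)
      also have "\<dots> = \<rho> * newton_slope f J + (p J - p 0)"
        unfolding newton_slope_def p_def[symmetric]
        by (simp add: sum.distrib sum_distrib_left sum_lessThan_telescope)
      finally show ?thesis using \<rho>0 by (simp add: field_simps)
    qed
    have "(\<lambda>J. (newton_slope g J + p 0 - p J) / \<rho>)
        \<longlonglongrightarrow> (poly (pderiv Q) 0 / (poly Q 0)\<^sup>2 + p 0 - 0) / \<rho>"
      by (intro tendsto_intros IH p0 \<rho>0)
    also have "(poly (pderiv Q) 0 / (poly Q 0)\<^sup>2 + p 0 - 0) / \<rho> = poly (pderiv P) 0 / (poly P 0)\<^sup>2"
    proof -
      have "poly Q 0 \<noteq> 0" using Qroot[of 0] by auto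
      moreover have "poly P 0 = \<rho> * poly Q 0" "poly (pderiv P) 0 = poly Q 0 + \<rho> * poly (pderiv Q) 0"
        unfolding PQ pderiv_mult by (simp_all add: \<rho>_def pderiv_pCons)
      moreover have "p 0 = 1 / poly P 0" by (simp add: p_def f_def)
      ultimately show ?thesis using \<rho>0 by (simp add: power2_eq_square field_simps)
    qed
    finally have "newton_slope f \<longlonglongrightarrow> poly (pderiv P) 0 / (poly P 0)\<^sup>2"
      by (simp add: slope[abs_def])
    then show ?case using LIMSEQ_Suc[OF p0] unfolding p_def f_def[abs_def] by blast
  qed
  then show ?thesis unfolding f_def by blast
qed

section \<open>The inequality between the reciprocal sums\<close>

text \<open>Each factor \<open>(z + b) / (z + a)\<close> is \<open>1 + (b - a) / (z + a)\<close>, and on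
the right half plane both \<open>1 / (z + a)\<close> and \<open>z / (z + a)\<close> are
bounded.\<close>

lemma quotient_near_identity:
  fixes a b :: "nat \<Rightarrow> real"
  assumes "\<And>j. j \<in> {1..l} \<Longrightarrow> 0 < a j"
  shows "\<exists>M. \<forall>z. 0 \<le> Re z \<longrightarrow>
     norm ((\<Prod>j=1..Suc l. z + of_real (b j)) / (\<Prod>j=1..l. z + of_real (a j)) - z) \<le> M"
  using assms
proof (induction l)
  case 0
  show ?case by (intro exI[of _ "\<bar>b 1\<bar>"]) simp
next
  case (Suc l)
  then obtain M where M: "\<And>z. 0 \<le> Re z \<Longrightarrow>
     norm ((\<Prod>j=1..Suc l. z + of_real (b j)) / (\<Prod>j=1..l. z + of_real (a j)) - z) \<le> M"
    by fastforce
  define t where "t = a (Suc l)"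
  define d where "d = b (Suc (Suc l)) - t"
  have t: "0 < t" using Suc.prems by (simp add: t_def)
  have M0: "0 \<le> M" using M[of 0] norm_ge_zero by (metis order_trans zero_complex.simps(1) order_refl)
  show ?case
  proof (intro exI allI impI)
    fix z :: complex assume z: "0 \<le> Re z"
    define R where "R = (\<Prod>j=1..Suc l. z + of_real (b j)) / (\<Prod>j=1..l. z + of_real (a j))"
    have zt: "t \<le> norm (z + of_real t)" "norm z \<le> norm (z + of_real t)"
    proof -
      show "t \<le> norm (z + of_real t)"
        using complex_Re_le_cmod[of "z + of_real t"] z by simp
      show "norm z \<le> norm (z + of_real t)"
        using z t by (auto simp: cmod_def intro!: power_mono)
    qed
    have nz: "z + of_real t \<noteq> 0" using zt t by auto
    have f1: "norm (of_real d * (z / (z + of_real t))) \<le> \<bar>d\<bar>"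
      using zt(2) t nz by (simp add: norm_mult norm_divide divide_le_eq mult_left_mono)
    have f2: "norm ((R - z) * (of_real d / (z + of_real t))) \<le> M * (\<bar>d\<bar> / t)"
      unfolding norm_mult norm_divide
      using M[OF z] zt t M0 by (intro mult_mono frac_le) (auto simp: R_def)
    have f3: "norm (R - z) \<le> M" using M[OF z] by (simp add: R_def)
    have "(\<Prod>j=1..Suc (Suc l). z + of_real (b j)) / (\<Prod>j=1..Suc l. z + of_real (a j))
        = R * ((z + of_real (b (Suc (Suc l)))) / (z + of_real t))"
      by (simp add: R_def t_def)
    also have "(z + of_real (b (Suc (Suc l)))) / (z + of_real t) = 1 + of_real d / (z + of_real t)"
      using nz by (simp add: d_def divide_simps)
    also have "R * \<dots> - z = (R - z) + (R - z) * (of_real d / (z + of_real t)) + of_real d * (z / (z + of_real t))"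
      by (simp add: algebra_simps diff_divide_distrib)
    also have "norm \<dots> \<le> M + M * (\<bar>d\<bar> / t) + \<bar>d\<bar>"
      using f1 f2 f3 by (intro norm_triangle_le add_mono) auto
    finally show "norm ((\<Prod>j=1..Suc (Suc l). z + of_real (b j)) / (\<Prod>j=1..Suc l. z + of_real (a j)) - z)
        \<le> M + M * (\<bar>d\<bar> / t) + \<bar>d\<bar>" .
  qed
qed

text \<open>At a root \<open>z\<close> the quotient of the two products equals
\<open>- a 0 * n / b 0\<close>. If \<open>Re z \<ge> 0\<close>, its distance from
\<open>z\<close> is at least \<open>a 0 * n / b 0\<close>, which for large \<open>n\<close>
exceeds the bound on the right half plane.\<close>

lemma eventually_left_half_plane_roots:
  fixes a b :: "nat \<Rightarrow> real"
  assumes a: "\<And>j. j \<in> {0..l} \<Longrightarrow> 0 < a j" and b: "0 < b 0"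
  shows "\<exists>n0::nat. \<forall>n\<ge>n0. \<forall>z. of_real (b 0) * (\<Prod>j=1..Suc l. z + of_real (b j))
     + of_real (a 0 * real n) * (\<Prod>j=1..l. z + of_real (a j)) = 0 \<longrightarrow> Re z < 0"
proof -
  obtain M where M: "\<And>z. 0 \<le> Re z \<Longrightarrow>
     norm ((\<Prod>j=1..Suc l. z + of_real (b j)) / (\<Prod>j=1..l. z + of_real (a j)) - z) \<le> M"
    using quotient_near_identity[of l a b] a by auto
  have a0: "0 < a 0" using a by simp
  obtain n0 :: nat where n0: "M * b 0 / a 0 < real n0" using reals_Archimedean2 by blast
  show ?thesis
  proof (intro exI allI impI, rule ccontr)
    fix n z
    assume n: "n0 \<le> n" and z: "\<not> Re z < 0" and
      root: "of_real (b 0) * (\<Prod>j=1..Suc l. z + of_real (b j))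
       + of_real (a 0 * real n) * (\<Prod>j=1..l. z + of_real (a j)) = 0"
    define U where "U = (\<Prod>j=1..Suc l. z + of_real (b j))"
    define V where "V = (\<Prod>j=1..l. z + of_real (a j))"
    have "z + of_real (a j) \<noteq> 0" if "j \<in> {1..l}" for j
    proof
      assume "z + of_real (a j) = 0"
      then have "Re (z + of_real (a j)) = 0" by simp
      with z a[of j] that show False by simp
    qed
    then have V: "V \<noteq> 0" by (simp add: V_def)
    have "of_real (b 0) * U + of_real (a 0 * real n) * V = 0"
      using root by (simp only: U_def V_def)
    then have "U / V = - of_real (a 0 * real n / b 0)"
      using V b by (simp add: field_simps eq_neg_iff_add_eq_0)
    then have "Re (U / V - z) = - (a 0 * real n / b 0) - Re z" by simp
    then have "a 0 * real n / b 0 \<le> norm (U / V - z)"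
      using z abs_Re_le_cmod[of "U / V - z"] by linarith
    also have "\<dots> \<le> M" using M[of z] z by (simp add: U_def V_def)
    finally have "real n \<le> M * b 0 / a 0" using a0 b by (simp add: field_simps)
    with n0 n show False by simp
  qed
qed

lemma pderiv_linear_prod_0:
  fixes c :: "nat \<Rightarrow> 'a::field_char_0"
  assumes "finite I" "\<And>j. j \<in> I \<Longrightarrow> c j \<noteq> 0"
  shows "poly (pderiv (\<Prod>j\<in>I. [:c j, 1:])) 0 = (\<Prod>j\<in>I. c j) * (\<Sum>j\<in>I. 1 / c j)"
proof -
  have "poly (pderiv (\<Prod>j\<in>I. [:c j, 1:])) 0 = (\<Sum>i\<in>I. \<Prod>j\<in>I - {i}. c j)"
    by (simp add: pderiv_prod poly_sum poly_prod pderiv_pCons)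
  also have "\<dots> = (\<Sum>i\<in>I. (\<Prod>j\<in>I. c j) * (1 / c i))"
    using assms by (intro sum.cong) (simp_all add: prod.remove)
  finally show ?thesis by (simp only: sum_distrib_left)
qed

text \<open>The \<open>j\<close>-th difference is a positive multiple of
\<open>\<alpha> + \<delta> * (\<Sum>i\<le>j. 1 / (c + n0 + i))\<close>, and the sum
diverges.\<close>

lemma square_coefficient_nonneg:
  fixes c \<alpha> \<delta> :: real
  assumes c: "0 < c"
    and cm: "\<And>j. 0 \<le> (bdiff ^^ j) (\<lambda>n. \<alpha> * (1 / (c + real n)) + \<delta> * (1 / (c + real n)\<^sup>2)) n0"
  shows "0 \<le> \<delta>"
proof (rule ccontr)
  assume "\<not> 0 \<le> \<delta>"
  define z where "z = c + real n0"
  have z: "0 < z" using c by (simp add: z_def)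
  define S where "S j = (\<Sum>i\<le>j. 1 / (z + real i))" for j
  have nonneg: "0 \<le> \<alpha> + \<delta> * S j" for j
  proof -
    define X where "X = fact j / pochhammer z (Suc j)"
    have "0 \<le> \<alpha> * X + \<delta> * (X * S j)"
      using cm[of j] by (simp only: bdiff_pow_add bdiff_pow_cmult bdiff_pow_inverse_linear[OF c]
        bdiff_pow_inverse_square[OF c] z_def S_def X_def)
    then have "X * 0 \<le> X * (\<alpha> + \<delta> * S j)" by (simp add: algebra_simps)
    moreover have "0 < X"
      using z unfolding X_def by (intro divide_pos_pos pochhammer_pos) simp_all
    ultimately show ?thesis by (simp only: mult_le_cancel_left_pos)
  qed
  have bound: "S j \<le> \<alpha> / - \<delta>" for j
  proof -
    have "S j * - \<delta> \<le> \<alpha>" using nonneg[of j] by (simp add: mult.commute)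
    moreover have "0 < - \<delta>" using \<open>\<not> 0 \<le> \<delta>\<close> by simp
    ultimately show ?thesis by (simp only: pos_le_divide_eq)
  qed
  \<comment> \<open>termwise comparison with the harmonic series, using \<open>z + i \<le> (z + 1) * (i + 1)\<close>\<close>
  have "harm (Suc j) \<le> (z + 1) * S j" for j
    unfolding harm_altdef S_def sum_distrib_left lessThan_Suc_atMost
  proof (intro sum_mono)
    fix i
    have "z + real i \<le> (z + 1) * real (Suc i)" using z by (simp add: algebra_simps)
    then show "inverse (real (Suc i)) \<le> (z + 1) * (1 / (z + real i))"
      using z by (simp add: field_simps)
  qed
  then have le: "harm (Suc j) \<le> (z + 1) * (\<alpha> / - \<delta>)" for j
    using order_trans[OF _ mult_left_mono[OF bound[of j], of "z + 1"]] z by simp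
  have "filterlim (harm :: nat \<Rightarrow> real) at_top sequentially" by (rule harm_at_top)
  then have "\<forall>\<^sub>F j in sequentially. (z + 1) * (\<alpha> / - \<delta>) < (harm j :: real)"
    by (simp add: filterlim_at_top_dense)
  then obtain J where "\<forall>j\<ge>J. (z + 1) * (\<alpha> / - \<delta>) < (harm j :: real)"
    by (auto simp: eventually_sequentially)
  then have "(z + 1) * (\<alpha> / - \<delta>) < harm (Suc J)" by simp
  with le[of J] show False by simp
qed

text \<open>Here \<open>L n\<close> is minus the derivative of \<open>1 / p(x, n)\<close> in
\<open>x\<close> at \<open>0\<close>. For large \<open>n\<close> it is the limit of Newton
slopes, which are nonnegative combinations of mixed differences even after differencing in
\<open>n\<close>; hence all differences of \<open>L\<close> at \<open>n0\<close> are
nonnegative. The coefficient of \<open>1 / (\<gamma> + n)\<^sup>2\<close> in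
\<open>L n\<close> is a positive multiple of the difference of the two sums.\<close>

lemma reciprocal_sums_of_joint_completely_monotone:
  fixes a b :: "nat \<Rightarrow> real"
  assumes a: "\<And>j. j \<in> {0..l} \<Longrightarrow> 0 < a j" and b: "\<And>j. j \<in> {0..Suc l} \<Longrightarrow> 0 < b j"
    and jcm: "joint_completely_monotone (\<lambda>m n. 1 /
      (b 0 * (\<Prod>j=1..Suc l. real m + b j) + a 0 * (\<Prod>j=1..l. real m + a j) * real n))"
  shows "(\<Sum>j=1..l. 1 / a j) \<le> (\<Sum>j=1..Suc l. 1 / b j)"
proof -
  define A where "A m = a 0 * (\<Prod>j=1..l. real m + a j)" for m
  define B where "B m = b 0 * (\<Prod>j=1..Suc l. real m + b j)" for m
  define X where "X m n = 1 / (B m + A m * real n)" for m n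
  define SA where "SA = (\<Sum>j=1..l. 1 / a j)"
  define SB where "SB = (\<Sum>j=1..Suc l. 1 / b j)"
  have b0: "0 < b 0" using b by simp
  define L where "L n = (B 0 * SB + A 0 * SA * real n) / (B 0 + A 0 * real n)\<^sup>2" for n
  have A: "0 < A m" for m
    unfolding A_def using a by (intro mult_pos_pos prod_pos) (auto intro: add_nonneg_pos)
  have B: "0 < B m" for m
    unfolding B_def using b by (intro mult_pos_pos prod_pos) (auto intro: add_nonneg_pos)
  obtain n0 :: nat where n0: "\<And>n z. n0 \<le> n \<Longrightarrow> of_real (b 0) * (\<Prod>j=1..Suc l. z + of_real (b j))
     + of_real (a 0 * real n) * (\<Prod>j=1..l. z + of_real (a j)) = 0 \<Longrightarrow> Re z < 0"
    using eventually_left_half_plane_roots[of l a b, OF a b0] by blast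
  have slope: "newton_slope (\<lambda>m. X m n) \<longlonglongrightarrow> L n" if n: "n0 \<le> n" for n
  proof -
    define U V where "U = (\<Prod>j=1..Suc l. [:complex_of_real (b j), 1:])"
      and "V = (\<Prod>j=1..l. [:complex_of_real (a j), 1:])"
    define P where "P = smult (of_real (b 0)) U + smult (of_real (a 0 * real n)) V"
    have poly: "poly P z = of_real (b 0) * (\<Prod>j=1..Suc l. z + of_real (b j))
       + of_real (a 0 * real n) * (\<Prod>j=1..l. z + of_real (a j))" for z
      by (simp only: P_def U_def V_def poly_add poly_smult poly_prod) (simp add: add.commute)
    have "poly P (of_nat m) = of_real (B m + A m * real n)" for m
      unfolding poly A_def B_def by simp
    then have inv: "(\<lambda>m. 1 / poly P (of_nat m)) = (\<lambda>m. complex_of_real (X m n))"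
      by (simp add: X_def)
    have b_nz: "complex_of_real (b j) \<noteq> 0" if "j \<in> {1..Suc l}" for j
      using b[of j] that by simp
    have a_nz: "complex_of_real (a j) \<noteq> 0" if "j \<in> {1..l}" for j
      using a[of j] that by simp
    have U': "poly (pderiv U) 0 = poly U 0 * of_real SB"
      using pderiv_linear_prod_0[of "{1..Suc l}" "\<lambda>j. complex_of_real (b j)", OF finite_atLeastAtMost b_nz]
      by (simp only: U_def SB_def poly_prod) simp
    have V': "poly (pderiv V) 0 = poly V 0 * of_real SA"
      using pderiv_linear_prod_0[of "{1..l}" "\<lambda>j. complex_of_real (a j)", OF finite_atLeastAtMost a_nz]
      by (simp only: V_def SA_def poly_prod) simp
    have U0: "of_real (b 0) * poly U 0 = of_real (B 0)" and V0: "of_real (a 0) * poly V 0 = of_real (A 0)"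
      unfolding U_def V_def A_def B_def by (simp_all add: poly_prod)
    have "poly P 0 = of_real (b 0) * poly U 0 + of_real (a 0) * poly V 0 * of_nat n"
      by (simp add: P_def)
    also have "\<dots> = of_real (B 0 + A 0 * real n)" by (simp add: U0 V0)
    finally have P0: "poly P 0 = of_real (B 0 + A 0 * real n)" .
    have "poly (pderiv P) 0
        = of_real (b 0) * poly U 0 * of_real SB + of_real (a 0) * poly V 0 * of_real SA * of_nat n"
      by (simp add: P_def pderiv_add pderiv_smult U' V')
    also have "\<dots> = of_real (B 0 * SB + A 0 * SA * real n)" by (simp add: U0 V0)
    finally have "poly (pderiv P) 0 = of_real (B 0 * SB + A 0 * SA * real n)" .
    with P0 have "poly (pderiv P) 0 / (poly P 0)\<^sup>2 = of_real (L n)"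
      by (simp add: L_def)
    moreover have "newton_slope (\<lambda>m. 1 / poly P (of_nat m)) \<longlonglongrightarrow> poly (pderiv P) 0 / (poly P 0)\<^sup>2"
      by (rule newton_slope_inverse_poly) (rule n0[OF n], simp only: poly)
    moreover have "newton_slope (\<lambda>m. complex_of_real (X m n)) = (\<lambda>J. of_real (newton_slope (\<lambda>m. X m n) J))"
      by (simp add: fun_eq_iff newton_slope_def bdiff_pow_of_real del: funpow.simps of_nat_Suc)
    ultimately show ?thesis unfolding inv by (simp add: tendsto_of_real_iff)
  qed
  have L_cm: "0 \<le> (bdiff ^^ j) L n0" for j
  proof (rule LIMSEQ_le_const)
    show "(\<lambda>J. (bdiff ^^ j) (\<lambda>n. newton_slope (\<lambda>m. X m n) J) n0) \<longlonglongrightarrow> (bdiff ^^ j) L n0"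
      by (rule bdiff_pow_tendsto[OF slope]) auto
    have scale: "(bdiff ^^ j) (\<lambda>n. f n / c) n = 1 / c * (bdiff ^^ j) f n" for f n and c :: real
      using bdiff_pow_cmult[of j "1 / c" f n] by simp
    have "0 \<le> (bdiff ^^ j) (\<lambda>n. newton_slope (\<lambda>m. X m n) J) n0" for J
    proof -
      have "(bdiff ^^ j) (\<lambda>n. newton_slope (\<lambda>m. X m n) J) n0
          = (\<Sum>i<J. 1 / real (Suc i) * (bdiff ^^ j) (\<lambda>n. (bdiff ^^ Suc i) (\<lambda>m. X m n) 0) n0)"
        unfolding newton_slope_def bdiff_pow_sum scale ..
      also have "\<dots> = (\<Sum>i<J. 1 / real (Suc i) * (bdiff ^^ Suc i) (\<lambda>m. (bdiff ^^ j) (X m) n0) 0)"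
        by (intro sum.cong refl arg_cong[where f = "\<lambda>t. _ * t"] bdiff_pow_commute[symmetric])
      also have "\<dots> \<ge> 0"
      proof (intro sum_nonneg mult_nonneg_nonneg)
        fix i
        show "0 \<le> (bdiff ^^ Suc i) (\<lambda>m. (bdiff ^^ j) (X m) n0) 0"
          using jcm unfolding joint_completely_monotone_iff X_def A_def B_def by blast
      qed simp
      finally show ?thesis .
    qed
    then show "\<exists>N. \<forall>J\<ge>N. 0 \<le> (bdiff ^^ j) (\<lambda>n. newton_slope (\<lambda>m. X m n) J) n0" by blast
  qed
  define \<gamma> where "\<gamma> = B 0 / A 0"
  have \<gamma>: "0 < \<gamma>" using A B by (simp add: \<gamma>_def)
  have L: "L = (\<lambda>n. SA / A 0 * (1 / (\<gamma> + real n)) + \<gamma> * (SB - SA) / A 0 * (1 / (\<gamma> + real n)\<^sup>2))"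
  proof
    fix n
    define g where "g = \<gamma> + real n"
    have g: "g \<noteq> 0" using \<gamma> by (simp add: g_def)
    have A0: "A 0 \<noteq> 0" using A[of 0] by simp
    have "B 0 = A 0 * \<gamma>" using A0 by (simp add: \<gamma>_def)
    then have "L n = A 0 * (SA * g + \<gamma> * (SB - SA)) / (A 0 * g)\<^sup>2"
      by (simp add: L_def g_def algebra_simps)
    also have "\<dots> = SA / A 0 * (1 / g) + \<gamma> * (SB - SA) / A 0 * (1 / g\<^sup>2)"
      using g A0 by (simp add: power2_eq_square add_divide_distrib)
    finally show "L n = SA / A 0 * (1 / (\<gamma> + real n)) + \<gamma> * (SB - SA) / A 0 * (1 / (\<gamma> + real n)\<^sup>2)"
      by (simp only: g_def)
  qed
  have "0 \<le> \<gamma> * (SB - SA) / A 0"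
    by (rule square_coefficient_nonneg[OF \<gamma> L_cm[unfolded L]])
  then have "SA \<le> SB"
    using \<gamma> A[of 0] by (simp add: zero_le_divide_iff zero_le_mult_iff)
  then show ?thesis by (simp only: SA_def SB_def)
qed

theorem theorem3p4:
  fixes l k :: nat and a b :: "nat \<Rightarrow> real"
    and A B :: "real \<Rightarrow> real" and p :: "real \<Rightarrow> real \<Rightarrow> real"
  assumes "1 \<le> l" and "l < k"
    and "\<And>i. i \<in> {0..l} \<Longrightarrow> 0 < a i"
    and "\<And>j. j \<in> {0..k} \<Longrightarrow> 0 < b j"
    and "inj_on a {0..l}" and "inj_on b {0..k}" and "a ` {0..l} \<inter> b ` {0..k} = {}"
    and "\<And>x. 0 \<le> x \<Longrightarrow> A x = a 0 * (\<Prod>j=1..l. x + a j)"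
    and "\<And>x. 0 \<le> x \<Longrightarrow> B x = b 0 * (\<Prod>j=1..k. x + b j)"
    and "\<And>x y. 0 \<le> x \<Longrightarrow> 0 \<le> y \<Longrightarrow> p x y = B x + A x * y"
  shows "(l = k - 1 \<longrightarrow> (\<forall>j\<in>{1..l}. b j \<le> a j \<and> a j \<le> b (j + 1)) \<longrightarrow>
            joint_completely_monotone (\<lambda>m n. 1 / p (real m) (real n)))
       \<and> (joint_completely_monotone (\<lambda>m n. 1 / p (real m) (real n)) \<longrightarrow>
            (\<Sum>j=1..l. 1 / a j) \<le> (\<Sum>j=1..k. 1 / b j))"
proof -
  have p: "(\<lambda>m n. 1 / p (real m) (real n)) = (\<lambda>m n. 1 /
      (b 0 * (\<Prod>j=1..k. real m + b j) + a 0 * (\<Prod>j=1..l. real m + a j) * real n))"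
    by (simp only: assms(8-10) of_nat_0_le_iff)
  have "joint_completely_monotone (\<lambda>m n. 1 / p (real m) (real n))"
    if "l = k - 1" and inter: "\<forall>j\<in>{1..l}. b j \<le> a j \<and> a j \<le> b (j + 1)"
  proof -
    have k: "k = Suc l" using that assms(2) by simp
    have "inj_on a {1..l}" using assms(5) by (rule inj_on_subset) auto
    then show ?thesis
      unfolding p k using assms(3,4) inter
      by (intro interlacing_imp_joint_completely_monotone) (auto simp: k)
  qed
  moreover have "(\<Sum>j=1..l. 1 / a j) \<le> (\<Sum>j=1..k. 1 / b j)"
    if jcm: "joint_completely_monotone (\<lambda>m n. 1 / p (real m) (real n))"
  proof -
    have "k \<le> Suc l"
      using degree_gap_of_joint_completely_monotone[OF assms(3,4) jcm[unfolded p]] .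
    then have k: "k = Suc l" using assms(2) by simp
    show ?thesis
      using reciprocal_sums_of_joint_completely_monotone[of l a b] assms(3,4) jcm
      unfolding p k by blast
  qed
  ultimately show ?thesis by blast
qed

end
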